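(* Let $(\mathbb{A},\circ,h)$ be a Euclidean metrized commutative algebra of dimension at least $2$. (1) If $(\mathbb{A},\circ,h)$ has negative sectional nonassociativity, then $\operatorname{Aut}(\mathbb{A},\circ,h)$ is finite. (2) If $(\mathbb{A},\circ,h)$ has nonpositive sectional nonassociativity, then either $\operatorname{Aut}(\mathbb{A},\circ,h)$ is finite or $(\mathbb{A},\circ,h)$ contains a trivial two-dimensional subalgebra (the possibilities are not exclusive).
   Context: A Euclidean metrized commutative algebra $(\mathbb{A},\circ,h)$ is a finite-dimensional real vector space with a commutative (not necessarily associative or unital) bilinear multiplication $\circ$ and a positive definite symmetric bilinear form $h$ with $h(x\circ y,z)=h(x,y\circ z)$ for all $x,y,z$. $\operatorname{Aut}(\mathbb{A},\circ,h)$ is the group of algebra automorphisms preserving $h$. For linearly independent $x,y$ the sectional nonassociativity is $$\mathscr{K}(x,y) = \frac{h(x\circ x,y\circ y)-h(x\circ y,x\circ y)}{h(x,x)h(y,y)-h(x,y)^2},$$ which depends only on $\operatorname{Span}\{x,y\}$. The algebra has negative (nonpositive) sectional nonassociativity if $\mathscr{K}(x,y)<0$ ($\leq 0$) for every two-dimensional subspace $\operatorname{Span}\{x,y\}$. A subalgebra is trivial if all products of its elements are zero. *)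

theory Defs
  imports "HOL-Analysis.Analysis"
begin

text \<open>
  The underlying vector space is the whole type \<open>'a::real_vector\<close>. Class \<open>real_vector\<close> carries no
  norm, inner product or topology, so the metric \<open>h\<close> is a parameter independent of the type, and
  finite-dimensionality is an explicit assumption.
\<close>

locale euclidean_metrized_comm_algebra =
  fixes mul :: "'a::real_vector \<Rightarrow> 'a \<Rightarrow> 'a"
    and h :: "'a \<Rightarrow> 'a \<Rightarrow> real"
  assumes finite_dim: "\<exists>B::'a set. finite B \<and> span B = UNIV"
    and bilinear_mul: "bilinear mul"
    and mul_commute: "mul x y = mul y x"
    and bilinear_h: "bilinear h"
    and h_sym: "h x y = h y x"
    and h_pos_def: "x \<noteq> 0 \<Longrightarrow> h x x > 0"
    and h_invariant: "h (mul x y) z = h x (mul y z)"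

definition metrized_automorphisms ::
    "('a::real_vector \<Rightarrow> 'a \<Rightarrow> 'a) \<Rightarrow> ('a \<Rightarrow> 'a \<Rightarrow> real) \<Rightarrow> ('a \<Rightarrow> 'a) set" where
  "metrized_automorphisms mul h =
    {g. linear g \<and> bij g \<and> (\<forall>x y. g (mul x y) = mul (g x) (g y))
        \<and> (\<forall>x y. h (g x) (g y) = h x y)}"

definition sectional_nonassociativity ::
    "('a::real_vector \<Rightarrow> 'a \<Rightarrow> 'a) \<Rightarrow> ('a \<Rightarrow> 'a \<Rightarrow> real) \<Rightarrow> 'a \<Rightarrow> 'a \<Rightarrow> real" where
  "sectional_nonassociativity mul h x y =
    (h (mul x x) (mul y y) - h (mul x y) (mul x y)) / (h x x * h y y - (h x y)\<^sup>2)"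

text \<open>
  The condition \<open>x \<noteq> y\<close> is needed because \<open>{x, y}\<close> collapses to a singleton, which is independent
  for \<open>x \<noteq> 0\<close>, when the two vectors coincide.
\<close>

definition linearly_independent_pair :: "'a::real_vector \<Rightarrow> 'a \<Rightarrow> bool" where
  "linearly_independent_pair x y \<longleftrightarrow> x \<noteq> y \<and> independent {x, y}"

definition negative_sectional_nonassociativity ::
    "('a::real_vector \<Rightarrow> 'a \<Rightarrow> 'a) \<Rightarrow> ('a \<Rightarrow> 'a \<Rightarrow> real) \<Rightarrow> bool" where
  "negative_sectional_nonassociativity mul h \<longleftrightarrow>
    (\<forall>x y. linearly_independent_pair x y \<longrightarrow> sectional_nonassociativity mul h x y < 0)"

definition nonpositive_sectional_nonassociativity ::
    "('a::real_vector \<Rightarrow> 'a \<Rightarrow> 'a) \<Rightarrow> ('a \<Rightarrow> 'a \<Rightarrow> real) \<Rightarrow> bool" where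
  "nonpositive_sectional_nonassociativity mul h \<longleftrightarrow>
    (\<forall>x y. linearly_independent_pair x y \<longrightarrow> sectional_nonassociativity mul h x y \<le> 0)"

definition subalgebra :: "('a::real_vector \<Rightarrow> 'a \<Rightarrow> 'a) \<Rightarrow> 'a set \<Rightarrow> bool" where
  "subalgebra mul S \<longleftrightarrow> subspace S \<and> (\<forall>x\<in>S. \<forall>y\<in>S. mul x y \<in> S)"

definition trivial_subalgebra :: "('a::real_vector \<Rightarrow> 'a \<Rightarrow> 'a) \<Rightarrow> 'a set \<Rightarrow> bool" where
  "trivial_subalgebra mul S \<longleftrightarrow> subalgebra mul S \<and> (\<forall>x\<in>S. \<forall>y\<in>S. mul x y = 0)"

end

theory Submission
  imports Defs
begin

text \<open>
  An infinite automorphism group forces a degenerate orthonormal pair: \<open>x\<close>, \<open>y\<close> with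
  \<open>x \<circ> x = y \<circ> y\<close> and \<open>x \<circ> y = 0\<close>. For such a pair the sectional nonassociativity equals
  \<open>h (x \<circ> x) (x \<circ> x) \<ge> 0\<close>. Hence it cannot be negative, and if it is nonpositive then
  \<open>x \<circ> x = y \<circ> y = x \<circ> y = 0\<close>, so \<open>x\<close> and \<open>y\<close> span a trivial two-dimensional subalgebra.

  The idea is clearest for a nonzero skew derivation \<open>D\<close>. Its eigenvalues are purely imaginary; if
  \<open>\<i>\<theta>\<close> is one of maximal modulus, with eigenvector \<open>z = x + \<i>y\<close>, then \<open>z \<circ> z\<close> is annihilated
  by \<open>D - 2\<i>\<theta>\<close>, and \<open>2\<i>\<theta>\<close> is too large to be an eigenvalue. So
  \<open>0 = z \<circ> z = (x \<circ> x - y \<circ> y) + 2\<i>(x \<circ> y)\<close>.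

  The same argument works for a single automorphism \<open>g \<noteq> id\<close> that rotates no vector by more than a
  right angle, which replaces Lie theory by two elementary facts. First, an infinite group of
  isometries contains such a \<open>g\<close>: by the pigeonhole principle two members have nearly equal matrices
  in an orthonormal basis, and \<open>g\<close> is their quotient
  (\<open>infinite_automorphisms_near_identity\<close>). Second, the plane that \<open>g\<close> rotates by its largest angle
  \<open>\<theta>\<close> is found by minimising \<open>h (g x) x\<close> over the unit sphere, the minimum being \<open>cos \<theta>\<close>. The
  products above are rotated by \<open>2\<theta>\<close>, and \<open>cos 2\<theta> < cos \<theta>\<close> contradicts minimality unless they
  vanish (\<open>slow_rotation_gives_degenerate_pair\<close>).
\<close>

section \<open>Orthonormal bases for the metric\<close>

text \<open>This is the first-order condition at a minimum of a quadratic form along a line.\<close>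

lemma linear_coefficient_zero_if_quadratic_nonneg:
  fixes a b :: real
  assumes "\<And>t. 0 \<le> t * b + t\<^sup>2 * a"
  shows "b = 0"
proof (rule ccontr)
  assume "b \<noteq> 0"
  \<comment> \<open>A negative value occurs at \<open>t = - b / d\<close> for every positive \<open>d > a\<close>.\<close>
  define d where "d = \<bar>a\<bar> + 1"
  have d: "d > 0" "a < d" by (auto simp: d_def)
  have "(- b / d) * b + (- b / d)\<^sup>2 * a = b\<^sup>2 * (a - d) / d\<^sup>2"
    using d by (simp add: field_simps power2_eq_square)
  also have "\<dots> < 0"
    using d \<open>b \<noteq> 0\<close> by (intro divide_neg_pos mult_pos_neg) auto
  finally show False using assms[of "- b / d"] by simp
qed

context euclidean_metrized_comm_algebra
begin

lemmas h_simps =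
  bilinear_ladd[OF bilinear_h] bilinear_radd[OF bilinear_h]
  bilinear_lmul[OF bilinear_h] bilinear_rmul[OF bilinear_h]
  bilinear_lsub[OF bilinear_h] bilinear_rsub[OF bilinear_h]
  bilinear_lneg[OF bilinear_h] bilinear_rneg[OF bilinear_h]
  bilinear_lzero[OF bilinear_h] bilinear_rzero[OF bilinear_h]

lemmas mul_simps =
  bilinear_ladd[OF bilinear_mul] bilinear_radd[OF bilinear_mul]
  bilinear_lmul[OF bilinear_mul] bilinear_rmul[OF bilinear_mul]
  bilinear_lsub[OF bilinear_mul] bilinear_rsub[OF bilinear_mul]
  bilinear_lzero[OF bilinear_mul] bilinear_rzero[OF bilinear_mul]

lemma h_sum_left: "h (\<Sum>i\<in>I. f i) y = (\<Sum>i\<in>I. h (f i) y)"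
  using bilinear_h by (auto simp: bilinear_def intro!: linear_sum[of "\<lambda>x. h x y", unfolded o_def])

lemma h_sum_right: "h y (\<Sum>i\<in>I. f i) = (\<Sum>i\<in>I. h y (f i))"
  by (subst (1 2) h_sym) (rule h_sum_left)

lemma h_nonneg: "0 \<le> h x x"
  using h_pos_def[of x] by (cases "x = 0") (auto simp: h_simps)

lemma h_self_eq_0_iff: "h x x = 0 \<longleftrightarrow> x = 0"
  using h_pos_def[of x] by (cases "x = 0") (auto simp: h_simps)

definition orthonormal :: "'a set \<Rightarrow> bool" where
  "orthonormal C \<longleftrightarrow> (\<forall>b\<in>C. \<forall>c\<in>C. h b c = (if b = c then 1 else 0))"

lemma gram_schmidt:
  assumes "finite B"
  shows "\<exists>C. finite C \<and> span C = span B \<and> orthonormal C"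
  using assms
proof (induction B rule: finite_induct)
  case empty
  show ?case by (intro exI[of _ "{}"]) (simp add: orthonormal_def)
next
  case (insert a B)
  then obtain C where C: "finite C" "span C = span B" "orthonormal C" by blast
  define p where "p = (\<Sum>c\<in>C. h a c *\<^sub>R c)"
  define r where "r = a - p"
  have p: "p \<in> span C" unfolding p_def by (intro span_sum span_scale span_base)
  have r_orth: "h r c = 0" if "c \<in> C" for c
  proof -
    have "h p c = (\<Sum>b\<in>C. h a b * (if b = c then 1 else 0))"
      unfolding p_def h_sum_left using C(3) that
      by (intro sum.cong) (auto simp: h_simps orthonormal_def)
    also have "\<dots> = h a c" using C(1) that by (simp add: if_distrib cong: if_cong)
    finally show ?thesis by (simp add: r_def h_simps)
  qed
  show ?case
  proof (cases "r = 0")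
    case True
    then have "a \<in> span B" using p C(2) by (simp add: r_def)
    then have "span (insert a B) = span B" by (rule span_redundant)
    then show ?thesis using C by auto
  next
    case False
    define u where "u = (1 / sqrt (h r r)) *\<^sub>R r"
    have pos: "h r r > 0" using False by (rule h_pos_def)
    have uu: "h u u = 1" using pos by (simp add: u_def h_simps)
    have uc: "h u c = 0" "h c u = 0" if "c \<in> C" for c
      using r_orth[OF that] h_sym[of c u] by (simp_all add: u_def h_simps)
    have on: "orthonormal (insert u C)"
      using C(3) uu uc by (auto simp: orthonormal_def)
    have r_eq: "r = sqrt (h r r) *\<^sub>R u" using pos by (simp add: u_def)
    have sub1: "insert u C \<subseteq> span (insert a B)"
    proof -
      have "C \<subseteq> span (insert a B)" "p \<in> span (insert a B)"
        using C(2) p span_superset[of C] span_mono[of B "insert a B"] by auto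
      moreover have "a \<in> span (insert a B)" by (simp add: span_base)
      ultimately show ?thesis by (auto simp: u_def r_def intro!: span_scale span_diff)
    qed
    have sub2: "insert a B \<subseteq> span (insert u C)"
    proof -
      have "B \<subseteq> span (insert u C)" "p \<in> span (insert u C)"
        using C(2) p span_superset[of B] span_mono[of C "insert u C"] by auto
      moreover have "r \<in> span (insert u C)"
        by (subst r_eq, intro span_scale span_base) simp
      moreover have "a = r + p" by (simp add: r_def)
      ultimately show ?thesis by (auto intro: span_add)
    qed
    have "span (insert u C) = span (insert a B)"
      using sub1 sub2 by (simp add: span_eq)
    then show ?thesis using on C(1) by blast
  qed
qed

lemma obtain_orthonormal_basis:
  obtains C where "finite C" "orthonormal C" "\<And>x. (\<Sum>c\<in>C. h x c *\<^sub>R c) = x"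
proof -
  obtain C where C: "finite C" "span C = UNIV" "orthonormal C"
    using finite_dim gram_schmidt by metis
  have "(\<Sum>c\<in>C. h x c *\<^sub>R c) = x" for x
  proof -
    have "x \<in> span C" using C(2) by simp
    then show ?thesis
    proof (induction rule: span_induct_alt)
      case base
      show ?case by (simp add: h_simps)
    next
      case (step k b y)
      have "(\<Sum>c\<in>C. h b c *\<^sub>R c) = (\<Sum>c\<in>C. if c = b then c else 0)"
        using C(3) step(1) by (intro sum.cong) (auto simp: orthonormal_def)
      also have "\<dots> = b" using C(1) step(1) by simp
      finally have b: "(\<Sum>c\<in>C. h b c *\<^sub>R c) = b" .
      have "(\<Sum>c\<in>C. h (k *\<^sub>R b + y) c *\<^sub>R c) =
          k *\<^sub>R (\<Sum>c\<in>C. h b c *\<^sub>R c) + (\<Sum>c\<in>C. h y c *\<^sub>R c)"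
        by (simp add: h_simps scaleR_add_left scaleR_sum_right sum.distrib)
      then show ?case using b step(2) by simp
    qed
  qed
  then show ?thesis using that C by blast
qed

lemma parseval:
  assumes "finite C" "orthonormal C" "\<And>x. (\<Sum>c\<in>C. h x c *\<^sub>R c) = x"
  shows "h x x = (\<Sum>c\<in>C. (h x c)\<^sup>2)"
proof -
  have "h x x = h (\<Sum>c\<in>C. h x c *\<^sub>R c) x" by (simp only: assms(3))
  also have "\<dots> = (\<Sum>c\<in>C. (h x c)\<^sup>2)"
    unfolding h_sum_left by (simp add: h_simps power2_eq_square h_sym[of _ x])
  finally show ?thesis .
qed

section \<open>Minimising a quadratic form on the unit sphere\<close>

text \<open>
  The underlying type has no topology, so compactness is used for the coordinate vectors of the unit
  sphere, which form a compact subset of the product space of all functions \<open>'a \<Rightarrow> real\<close>. The vector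
  \<open>v\<close> only witnesses that the sphere is nonempty.
\<close>

lemma quadratic_form_attains_min_on_sphere:
  assumes "linear g" and "(v::'a) \<noteq> 0"
  obtains x where "h x x = 1" "\<And>y. h (g x) x * h y y \<le> h (g y) y"
proof -
  obtain C where C: "finite C" "orthonormal C" "\<And>x. (\<Sum>c\<in>C. h x c *\<^sub>R c) = x"
    using obtain_orthonormal_basis by blast
  \<comment> \<open>Coordinates outside the basis are pinned to \<open>0\<close>: this keeps every factor compact, so that
    Tychonoff's theorem applies to the product over the whole type.\<close>
  define S where "S = {f. (\<Sum>c\<in>C. (f c)\<^sup>2) = (1::real)} \<inter>
    PiE UNIV (\<lambda>c::'a. if c \<in> C then {-1..1} else {0})"
  define vec where "vec f = (\<Sum>c\<in>C. f c *\<^sub>R c)" for f :: "'a \<Rightarrow> real"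
  define F where "F f = h (g (vec f)) (vec f)" for f
  have F: "F f = (\<Sum>c\<in>C. \<Sum>d\<in>C. f c * f d * h (g c) d)" for f
    unfolding F_def vec_def linear_sum[OF assms(1)] h_sum_left unfolding h_sum_right
    by (simp add: linear_scale[OF assms(1)] h_simps algebra_simps sum_distrib_left)
  have coord: "continuous_on UNIV (\<lambda>f::'a \<Rightarrow> real. f c)" for c
    by (intro continuous_on_product_coordinates)
  have "compact (PiE UNIV (\<lambda>c::'a. if c \<in> C then {-1..1} else {0::real}))"
    unfolding compactin_euclidean_iff[symmetric] euclidean_product_topology[symmetric]
    by (subst compactin_PiE) auto
  moreover have "closed {f::'a\<Rightarrow>real. (\<Sum>c\<in>C. (f c)\<^sup>2) = 1}"
    by (intro closed_Collect_eq continuous_intros coord)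
  ultimately have "compact S"
    unfolding S_def by (intro closed_Int_compact)
  have contF: "continuous_on S F"
    unfolding F[abs_def]
    by (intro continuous_intros continuous_on_subset[OF coord]) auto
  define co where "co y = (\<lambda>c. if c \<in> C then h y c else 0)" for y
  have co_S: "co y \<in> S" if "h y y = 1" for y
  proof -
    have s: "(\<Sum>c\<in>C. (h y c)\<^sup>2) = 1" using parseval[OF C, of y] that by simp
    have "\<bar>h y c\<bar> \<le> 1" if "c \<in> C" for c
    proof -
      have "(h y c)\<^sup>2 \<le> 1"
        using s member_le_sum[OF that, of "\<lambda>c. (h y c)\<^sup>2"] C(1) by simp
      then show ?thesis by (simp add: abs_square_le_1)
    qed
    then show ?thesis using s by (auto simp: S_def co_def abs_le_iff)
  qed
  have vec_co: "vec (co y) = y" for y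
    using C(3)[of y] by (simp add: vec_def co_def)
  have normalized: "h ((1 / sqrt (h y y)) *\<^sub>R y) ((1 / sqrt (h y y)) *\<^sub>R y) = 1"
    if "y \<noteq> 0" for y
    using h_pos_def[OF that] by (simp add: h_simps)
  have "S \<noteq> {}" using co_S[OF normalized[OF assms(2)]] by blast
  with \<open>compact S\<close> contF obtain f where f: "f \<in> S" "\<And>f'. f' \<in> S \<Longrightarrow> F f \<le> F f'"
    by (metis continuous_attains_inf)
  have orth: "h c d = (if c = d then 1 else 0)" if "c \<in> C" "d \<in> C" for c d
    using C(2) that by (auto simp: orthonormal_def)
  have "h (vec f) (vec f) = (\<Sum>c\<in>C. \<Sum>d\<in>C. f c * f d * h c d)"
    unfolding vec_def h_sum_left unfolding h_sum_right
    by (simp add: h_simps algebra_simps sum_distrib_left)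
  also have "\<dots> = (\<Sum>c\<in>C. \<Sum>d\<in>C. if c = d then (f c)\<^sup>2 else 0)"
    by (intro sum.cong refl) (auto simp: orth power2_eq_square)
  also have "\<dots> = 1" using f(1) C(1) by (simp add: S_def)
  finally have unit: "h (vec f) (vec f) = 1" .
  have "h (g (vec f)) (vec f) * h y y \<le> h (g y) y" for y
  proof (cases "y = 0")
    case True
    then show ?thesis by (simp add: h_simps linear_0[OF assms(1)])
  next
    case False
    define z where "z = (1 / sqrt (h y y)) *\<^sub>R y"
    have "h (g (vec f)) (vec f) \<le> h (g z) z"
      using f(2)[OF co_S[OF normalized[OF False]]] by (simp add: F_def vec_co z_def)
    also have "\<dots> = h (g y) y / h y y"
      using h_pos_def[OF False] by (simp add: z_def linear_scale[OF assms(1)] h_simps)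
    finally show ?thesis using h_pos_def[OF False] by (simp add: field_simps)
  qed
  with unit show ?thesis using that by blast
qed

section \<open>A nontrivial automorphism that rotates by at most a right angle\<close>

lemma automorphism_quotient:
  assumes "g \<in> metrized_automorphisms mul h" "k \<in> metrized_automorphisms mul h"
  shows "inv k \<circ> g \<in> metrized_automorphisms mul h"
proof -
  have g: "linear g" "bij g" "\<And>x y. g (mul x y) = mul (g x) (g y)" "\<And>x y. h (g x) (g y) = h x y"
    and k: "linear k" "bij k" "\<And>x y. k (mul x y) = mul (k x) (k y)" "\<And>x y. h (k x) (k y) = h x y"
    using assms by (auto simp: metrized_automorphisms_def)
  have kk: "k (inv k x) = x" for x using k(2) by (simp add: bij_is_surj surj_f_inv_f)
  have inj: "k x = k y \<Longrightarrow> x = y" for x y using k(2) by (meson bij_is_inj injD)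
  have "linear (inv k)"
    by (intro linearI; rule inj) (simp_all add: kk linear_add[OF k(1)] linear_scale[OF k(1)])
  then have 1: "linear (inv k \<circ> g)" using g(1) by (rule linear_compose[rotated])
  have 2: "bij (inv k \<circ> g)" using g(2) k(2) by (simp add: bij_comp bij_imp_bij_inv)
  have 3: "inv k (g (mul x y)) = mul (inv k (g x)) (inv k (g y))" for x y
    by (rule inj) (simp add: kk k(3) g(3))
  have 4: "h (inv k (g x)) (inv k (g y)) = h x y" for x y
    using k(4)[of "inv k (g x)" "inv k (g y)"] by (simp add: kk g(4))
  show ?thesis using 1 2 3 4 by (simp add: metrized_automorphisms_def)
qed

lemma h_unit_vectors_bound:
  assumes "h x x = 1" "h y y = 1"
  shows "\<bar>h x y\<bar> \<le> 1"
proof -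
  have "0 \<le> h (x - y) (x - y)" "0 \<le> h (x + y) (x + y)" by (rule h_nonneg)+
  then show ?thesis using assms h_sym[of x y] by (simp add: h_simps)
qed

text \<open>
  Round the matrix entries of each automorphism down to multiples of \<open>1 / N\<close>. The entries lie in
  \<open>[-1, 1]\<close>, so only finitely many rounded matrices exist, and two distinct automorphisms \<open>g\<close>, \<open>k\<close>
  share one. Then \<open>g\<close> and \<open>k\<close> differ by an operator of norm at most \<open>1\<close>, which makes
  \<open>h (g x) (k x) \<ge> 0\<close>; this number is \<open>h (k\<inverse> (g x)) x\<close>.
\<close>

lemma infinite_automorphisms_near_identity:
  assumes "infinite (metrized_automorphisms mul h)"
  obtains g where "g \<in> metrized_automorphisms mul h" "g \<noteq> id" "\<And>x. 0 \<le> h (g x) x"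
proof -
  let ?G = "metrized_automorphisms mul h"
  obtain C where C: "finite C" "orthonormal C" "\<And>x. (\<Sum>c\<in>C. h x c *\<^sub>R c) = x"
    using obtain_orthonormal_basis by blast
  have unit: "h c c = 1" if "c \<in> C" for c using C(2) that by (simp add: orthonormal_def)
  \<comment> \<open>An operator on an \<open>n\<close>-dimensional space with entries at most \<open>1 / N\<close> has norm at most
    \<open>n\<^sup>2 / N\<close>; the summand \<open>1\<close> keeps \<open>N\<close> positive.\<close>
  define N where "N = real (card C) ^ 2 + 1"
  have N: "N > 0" by (simp add: N_def add_nonneg_pos)
  define code where "code g = restrict (\<lambda>(b, c). \<lfloor>N * h (g b) c\<rfloor>) (C \<times> C)" for g
  have "code ` ?G \<subseteq> PiE (C \<times> C) (\<lambda>_. {\<lfloor>- N\<rfloor>..\<lfloor>N\<rfloor>})"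
  proof (rule image_subsetI)
    fix g assume g: "g \<in> ?G"
    have "\<lfloor>N * h (g b) c\<rfloor> \<in> {\<lfloor>- N\<rfloor>..\<lfloor>N\<rfloor>}" if "b \<in> C" "c \<in> C" for b c
    proof -
      have "\<bar>h (g b) c\<bar> \<le> 1"
        using g unit that by (intro h_unit_vectors_bound) (auto simp: metrized_automorphisms_def)
      then have "- N \<le> N * h (g b) c" "N * h (g b) c \<le> N"
        using N mult_left_mono[of "-1" "h (g b) c" N] mult_left_mono[of "h (g b) c" 1 N] by auto
      then show ?thesis by (auto intro: floor_mono)
    qed
    then show "code g \<in> PiE (C \<times> C) (\<lambda>_. {\<lfloor>- N\<rfloor>..\<lfloor>N\<rfloor>})"
      by (auto simp: code_def)
  qed
  moreover have "finite (PiE (C \<times> C) (\<lambda>_. {\<lfloor>- N\<rfloor>..\<lfloor>N\<rfloor>}))"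
    using C(1) by (intro finite_PiE) auto
  ultimately have "finite (code ` ?G)" by (rule finite_subset)
  then have "\<not> inj_on code ?G" using assms finite_imageD by blast
  then obtain g k where gk: "g \<in> ?G" "k \<in> ?G" "g \<noteq> k" "code g = code k"
    unfolding inj_on_def by blast
  have close: "\<bar>h (g b) c - h (k b) c\<bar> \<le> 1 / N" if "b \<in> C" "c \<in> C" for b c
  proof -
    have "\<lfloor>N * h (g b) c\<rfloor> = \<lfloor>N * h (k b) c\<rfloor>"
      using fun_cong[OF gk(4), of "(b, c)"] that by (simp add: code_def)
    then have "\<bar>N * h (g b) c - N * h (k b) c\<bar> \<le> 1" by linarith
    then have "N * \<bar>h (g b) c - h (k b) c\<bar> \<le> 1"
      using N by (simp add: abs_mult flip: right_diff_distrib)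
    then show ?thesis using N by (simp add: field_simps)
  qed
  have lin: "linear g" "linear k"
    and isom: "h (k x) (k y) = h x y" for x y
    using gk by (auto simp: metrized_automorphisms_def)
  have coord_bound: "\<bar>h x c\<bar> \<le> sqrt (h x x)" if "c \<in> C" for x c
  proof -
    have "(h x c)\<^sup>2 \<le> h x x"
      using parseval[OF C, of x] member_le_sum[OF that, of "\<lambda>c. (h x c)\<^sup>2"] C(1) by simp
    then show ?thesis by (simp add: real_le_rsqrt)
  qed
  have diff_small: "\<bar>h (g x - k x) y\<bar> \<le> sqrt (h x x) * sqrt (h y y)" for x y
  proof -
    have "g x - k x = (\<Sum>b\<in>C. h x b *\<^sub>R (g b - k b))"
      by (subst (1 2) C(3)[of x, symmetric]) (simp add: linear_sum[OF lin(1)] linear_sum[OF lin(2)] linear_scale[OF lin(1)]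
        linear_scale[OF lin(2)] scaleR_diff_right sum_subtractf)
    then have "h (g x - k x) y = (\<Sum>b\<in>C. h x b * h (g b - k b) y)"
      by (simp add: h_sum_left h_simps)
    also have "\<dots> = (\<Sum>b\<in>C. \<Sum>c\<in>C. h x b * (h y c * h (g b - k b) c))"
    proof (intro sum.cong refl)
      fix b
      have "h (g b - k b) y = (\<Sum>c\<in>C. h y c * h (g b - k b) c)"
        by (subst C(3)[of y, symmetric]) (simp only: h_sum_right h_simps real_scaleR_def)
      then show "h x b * h (g b - k b) y = (\<Sum>c\<in>C. h x b * (h y c * h (g b - k b) c))"
        by (simp add: sum_distrib_left)
    qed
    also have "\<bar>\<dots>\<bar> \<le> (\<Sum>b\<in>C. \<Sum>c\<in>C. sqrt (h x x) * (sqrt (h y y) * (1 / N)))"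
    proof (intro order_trans[OF sum_abs] sum_mono)
      fix b c assume bc: "b \<in> C" "c \<in> C"
      have "\<bar>h (g b - k b) c\<bar> \<le> 1 / N" using close[OF bc] by (simp add: h_simps)
      then show "\<bar>h x b * (h y c * h (g b - k b) c)\<bar> \<le> sqrt (h x x) * (sqrt (h y y) * (1 / N))"
        unfolding abs_mult using coord_bound bc N h_nonneg
        by (intro mult_mono mult_nonneg_nonneg) auto
    qed
    also have "\<dots> = (sqrt (h x x) * sqrt (h y y)) * ((real (card C))\<^sup>2 / N)"
      by (simp add: power2_eq_square)
    also have "\<dots> \<le> (sqrt (h x x) * sqrt (h y y)) * 1"
      using N h_nonneg by (intro mult_left_mono) (auto simp: N_def)
    finally show ?thesis by simp
  qed
  have kk: "k (inv k x) = x" for x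
    using gk(2) by (simp add: metrized_automorphisms_def bij_is_surj surj_f_inv_f)
  show ?thesis
  proof (rule that)
    show "inv k \<circ> g \<in> ?G" using gk by (intro automorphism_quotient)
    show "inv k \<circ> g \<noteq> id"
    proof
      assume id: "inv k \<circ> g = id"
      have "k x = g x" for x using fun_cong[OF id, of x] kk[of "g x"] by simp
      then show False using gk(3) by auto
    qed
    show "0 \<le> h ((inv k \<circ> g) x) x" for x
    proof -
      have "h ((inv k \<circ> g) x) x = h (g x) (k x)"
        using isom[of "inv k (g x)" x] by (simp add: kk)
      also have "\<dots> = h (g x - k x) (k x) + h (k x) (k x)" by (simp add: h_simps)
      also have "\<dots> \<ge> 0"
        using diff_small[of x "k x"] h_nonneg[of x] by (simp add: isom)
      finally show ?thesis .
    qed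
  qed
qed

section \<open>The plane of largest rotation angle\<close>

text \<open>
  A unit vector \<open>x\<close> minimising \<open>h (g x) x\<close> is an eigenvector, for the smallest eigenvalue \<open>2c\<close>, of
  the symmetric operator \<open>g + g\<inverse>\<close>. Hence \<open>g\<close> preserves the plane spanned by \<open>x\<close> and \<open>g x\<close> and
  rotates it by the angle \<open>\<theta>\<close> with \<open>cos \<theta> = c\<close>. Writing \<open>z = x + \<i>y\<close> for an orthonormal basis of
  this plane, the real and imaginary parts \<open>p\<close>, \<open>q\<close> of \<open>z \<circ> z\<close> are rotated by \<open>2\<theta>\<close>, so that
  \<open>h (g p) p + h (g q) q = cos 2\<theta> (h p p + h q q)\<close>. Since \<open>cos 2\<theta> < cos \<theta>\<close>, minimality of
  \<open>cos \<theta>\<close> forces \<open>p = q = 0\<close>.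
\<close>

lemma slow_rotation_gives_degenerate_pair:
  assumes "g \<in> metrized_automorphisms mul h" "g \<noteq> id" "\<And>x. 0 \<le> h (g x) x"
  obtains x y where "h x x = 1" "h y y = 1" "h x y = 0" "mul x x = mul y y" "mul x y = 0"
proof -
  have lin: "linear g" and surj: "surj g" and hom: "\<And>x y. g (mul x y) = mul (g x) (g y)"
    and isom: "\<And>x y. h (g x) (g y) = h x y"
    using assms(1) by (auto simp: metrized_automorphisms_def bij_is_surj)
  note g_simps = linear_add[OF lin] linear_diff[OF lin] linear_scale[OF lin]
  obtain v where v: "g v \<noteq> v" using assms(2) by (metis eq_id_iff)
  then have "v \<noteq> 0" using linear_0[OF lin] by auto
  obtain x where xx: "h x x = 1" and xmin: "\<And>y. h (g x) x * h y y \<le> h (g y) y"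
    using quadratic_form_attains_min_on_sphere[OF lin \<open>v \<noteq> 0\<close>] by blast
  define c where "c = h (g x) x"
  have min: "c * h y y \<le> h (g y) y" for y using xmin by (simp add: c_def)
  have "0 \<le> c" using assms(3) by (simp add: c_def)
  have "c < 1"
  proof -
    have "0 < h (g v - v) (g v - v)" using v by (intro h_pos_def) simp
    then have "h (g v) v < h v v" using isom[of v v] h_sym[of v "g v"] by (simp add: h_simps)
    then have "c * h v v < 1 * h v v" using min[of v] by simp
    then show ?thesis using h_pos_def[OF \<open>v \<noteq> 0\<close>] by simp
  qed
  have euler: "h (g x) w + h x (g w) = 2 * c * h x w" for w
  proof -
    have "h (g x) w + h x (g w) - 2 * c * h x w = 0"
    proof (rule linear_coefficient_zero_if_quadratic_nonneg)
      fix t :: real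
      have "0 \<le> h (g (x + t *\<^sub>R w)) (x + t *\<^sub>R w) - c * h (x + t *\<^sub>R w) (x + t *\<^sub>R w)"
        using min[of "x + t *\<^sub>R w"] by simp
      also have "\<dots> = t * (h (g x) w + h x (g w) - 2 * c * h x w) + t\<^sup>2 * (h (g w) w - c * h w w)"
        using xx h_sym[of x w] h_sym[of x "g w"]
        by (simp add: g_simps h_simps c_def[symmetric] algebra_simps power2_eq_square)
      finally show "0 \<le> t * (h (g x) w + h x (g w) - 2 * c * h x w) + t\<^sup>2 * (h (g w) w - c * h w w)" .
    qed
    then show ?thesis by simp
  qed
  \<comment> \<open>Testing the previous equation against vectors of the form \<open>g w\<close> avoids \<open>g\<inverse>\<close>.\<close>
  have recurrence: "g (g x) = (2 * c) *\<^sub>R g x - x"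
  proof -
    define r where "r = g (g x) - (2 * c) *\<^sub>R g x + x"
    obtain w where w: "r = g w" using surj by (metis surjD)
    have "h r z = h (g (g x)) z - 2 * c * h (g x) z + h x z" for z
      by (simp add: r_def h_simps)
    from this[of "g w"] have "h r r = h (g (g x)) (g w) - 2 * c * h (g x) (g w) + h x (g w)"
      by (simp only: w[symmetric])
    also have "\<dots> = 0" using euler[of w] by (simp add: isom)
    finally show ?thesis by (simp add: h_self_eq_0_iff r_def algebra_simps eq_neg_iff_add_eq_0)
  qed
  define s where "s = sqrt (1 - c\<^sup>2)"
  have s2: "s\<^sup>2 = 1 - c\<^sup>2" and "s > 0"
    using \<open>0 \<le> c\<close> \<open>c < 1\<close> by (auto simp: s_def power_le_one abs_square_less_1)
  define y where "y = (1 / s) *\<^sub>R (g x - c *\<^sub>R x)"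
  have gx: "g x = c *\<^sub>R x + s *\<^sub>R y" using \<open>s > 0\<close> by (simp add: y_def)
  have gy: "g y = c *\<^sub>R y - s *\<^sub>R x"
  proof -
    have "s *\<^sub>R g y = g (g x) - c *\<^sub>R g x" using \<open>s > 0\<close> by (simp add: y_def g_simps)
    also have "\<dots> = c *\<^sub>R g x - x" 
    proof -
      have "(2 * c) *\<^sub>R g x = c *\<^sub>R g x + c *\<^sub>R g x" by (simp flip: scaleR_add_left)
      then show ?thesis unfolding recurrence by simp
    qed
    also have "\<dots> = (c\<^sup>2 - 1) *\<^sub>R x + (s * c) *\<^sub>R y" 
      unfolding gx by (simp add: algebra_simps power2_eq_square)
    also have "c\<^sup>2 - 1 = - (s * s)" using s2 by (simp add: power2_eq_square)
    finally have "s *\<^sub>R g y = s *\<^sub>R (c *\<^sub>R y - s *\<^sub>R x)" by (simp add: algebra_simps)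
    then show ?thesis using \<open>s > 0\<close> by simp
  qed
  have xy: "h x y = 0" using xx h_sym[of x "g x"] by (simp add: y_def h_simps c_def)
  have yy: "h y y = 1"
  proof -
    have "1 = h (c *\<^sub>R x + s *\<^sub>R y) (c *\<^sub>R x + s *\<^sub>R y)" using isom[of x x] xx gx by simp
    also have "\<dots> = c\<^sup>2 + s\<^sup>2 * h y y"
      using xx xy h_sym[of x y] by (simp add: h_simps power2_eq_square)
    finally have "s\<^sup>2 * h y y = s\<^sup>2 * 1" using s2 by linarith
    then show ?thesis using \<open>s > 0\<close> by simp
  qed
  define p where "p = mul x x - mul y y"
  define q where "q = mul x y + mul x y"
  \<comment> \<open>The coefficients are \<open>cos 2\<theta>\<close> and, split over the doubled vector, \<open>sin 2\<theta> = 2 c s\<close>.\<close>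
  have gp: "g p = (c * c - s * s) *\<^sub>R p + (c * s) *\<^sub>R (q + q)"
    unfolding p_def q_def g_simps hom gx gy using mul_commute[of y x]
    by (simp add: mul_simps algebra_simps)
  have gq: "g q = (c * c - s * s) *\<^sub>R q - (c * s) *\<^sub>R (p + p)"
    unfolding p_def q_def g_simps hom gx gy using mul_commute[of y x]
    by (simp add: mul_simps algebra_simps)
  define m where "m = h p p + h q q"
  have "c * m \<le> h (g p) p + h (g q) q"
    using min[of p] min[of q] by (simp add: m_def algebra_simps)
  also have "\<dots> = (c\<^sup>2 - s\<^sup>2) * m"
    unfolding gp gq m_def using h_sym[of p q] by (simp add: h_simps algebra_simps power2_eq_square)
  finally have "0 \<le> (c\<^sup>2 - s\<^sup>2 - c) * m" by (simp add: algebra_simps)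
  also have "c\<^sup>2 - s\<^sup>2 - c = - ((2 * c + 1) * (1 - c))"
    using s2 by (simp add: algebra_simps power2_eq_square)
  finally have "((2 * c + 1) * (1 - c)) * m \<le> 0" by simp
  moreover have "(2 * c + 1) * (1 - c) > 0" using \<open>0 \<le> c\<close> \<open>c < 1\<close> by simp
  ultimately have "m \<le> 0" by (meson mult_pos_pos not_le)
  then have "h p p = 0" "h q q = 0" using h_nonneg[of p] h_nonneg[of q] by (auto simp: m_def)
  then have "p = 0" "q = 0" by (simp_all add: h_self_eq_0_iff)
  then show ?thesis using that[OF xx yy xy] by (simp add: p_def q_def flip: scaleR_2)
qed

section \<open>Sectional nonassociativity of the degenerate plane\<close>

lemma orthonormal_pair_independent:
  assumes "h x x = 1" "h y y = 1" "h x y = 0"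
  shows "linearly_independent_pair x y"
proof -
  have "x \<noteq> y" using assms by auto
  have "y \<noteq> 0" using assms(2) by (auto simp: h_simps)
  have "x \<notin> span {y}"
  proof
    assume "x \<in> span {y}"
    then obtain k where "x = k *\<^sub>R y" by (auto simp: span_singleton)
    then show False using assms by (auto simp: h_simps)
  qed
  then show ?thesis using \<open>x \<noteq> y\<close> \<open>y \<noteq> 0\<close>
    by (auto simp: linearly_independent_pair_def independent_insert)
qed

lemma trivial_subalgebra_span_pair:
  assumes "mul x x = 0" "mul y y = 0" "mul x y = 0"
  shows "trivial_subalgebra mul (span {x, y})"
proof -
  have "mul a b = 0" if ab: "a \<in> span {x, y}" "b \<in> span {x, y}" for a b
  proof -
    have split: "\<exists>i j. z = i *\<^sub>R x + j *\<^sub>R y" if z: "z \<in> span {x, y}" for z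
    proof -
      obtain i where "z - i *\<^sub>R x \<in> span {y}" 
        using z span_breakdown_eq[of z x "{y}"] by auto
      then obtain j where "z - i *\<^sub>R x = j *\<^sub>R y" by (auto simp: span_singleton)
      then have "z = i *\<^sub>R x + j *\<^sub>R y" by (simp add: algebra_simps)
      then show ?thesis by blast
    qed
    obtain i j i' j' where "a = i *\<^sub>R x + j *\<^sub>R y" "b = i' *\<^sub>R x + j' *\<^sub>R y"
      using split[OF ab(1)] split[OF ab(2)] by blast
    then show ?thesis using assms mul_commute[of y x] by (simp add: mul_simps)
  qed
  then show ?thesis
    by (auto simp: trivial_subalgebra_def subalgebra_def span_zero)
qed

text \<open>
  For an orthonormal pair the denominator of the sectional nonassociativity is \<open>1\<close>, and the equations
  of a degenerate pair turn its numerator into the square of the length of \<open>x \<circ> x\<close>.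
\<close>

lemma infinite_automorphisms_degenerate_pair:
  assumes "infinite (metrized_automorphisms mul h)"
  obtains x y where "linearly_independent_pair x y" "mul x x = mul y y" "mul x y = 0"
    "sectional_nonassociativity mul h x y = h (mul x x) (mul x x)"
proof -
  obtain g where "g \<in> metrized_automorphisms mul h" "g \<noteq> id" "\<And>x. 0 \<le> h (g x) x"
    using infinite_automorphisms_near_identity[OF assms] by blast
  then obtain x y where xy: "h x x = 1" "h y y = 1" "h x y = 0" "mul x x = mul y y" "mul x y = 0"
    using slow_rotation_gives_degenerate_pair by blast
  then have "sectional_nonassociativity mul h x y = h (mul x x) (mul x x)"
    by (simp add: sectional_nonassociativity_def h_simps)
  then show ?thesis using that orthonormal_pair_independent xy by blast
qed

end

theorem lemma8p9:
  fixes mul :: "'a::real_vector \<Rightarrow> 'a \<Rightarrow> 'a"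
    and h :: "'a \<Rightarrow> 'a \<Rightarrow> real"
  assumes "euclidean_metrized_comm_algebra mul h"
    and "dim (UNIV :: 'a set) \<ge> 2"
  shows "(negative_sectional_nonassociativity mul h \<longrightarrow> finite (metrized_automorphisms mul h)) \<and>
    (nonpositive_sectional_nonassociativity mul h \<longrightarrow>
      finite (metrized_automorphisms mul h) \<or>
      (\<exists>S. trivial_subalgebra mul S \<and> dim S = 2))"
proof (cases "finite (metrized_automorphisms mul h)")
  case True
  then show ?thesis by simp
next
  case False
  interpret euclidean_metrized_comm_algebra mul h by (rule assms(1))
  obtain x y where xy: "linearly_independent_pair x y" "mul x x = mul y y" "mul x y = 0"
    and K: "sectional_nonassociativity mul h x y = h (mul x x) (mul x x)"
    using infinite_automorphisms_degenerate_pair[OF False] by blast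
  have "\<not> negative_sectional_nonassociativity mul h"
  proof
    assume "negative_sectional_nonassociativity mul h"
    then have "h (mul x x) (mul x x) < 0"
      using xy(1) K unfolding negative_sectional_nonassociativity_def by metis
    then show False using h_nonneg[of "mul x x"] by simp
  qed
  moreover have "\<exists>S. trivial_subalgebra mul S \<and> dim S = 2"
    if "nonpositive_sectional_nonassociativity mul h"
  proof -
    have "h (mul x x) (mul x x) \<le> 0"
      using that xy(1) K unfolding nonpositive_sectional_nonassociativity_def by metis
    then have "h (mul x x) (mul x x) = 0" using h_nonneg[of "mul x x"] by simp
    then have "mul x x = 0" by (simp add: h_self_eq_0_iff)
    then have "trivial_subalgebra mul (span {x, y})"
      using xy by (intro trivial_subalgebra_span_pair) auto
    moreover have "dim (span {x, y}) = 2"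
      using xy(1) by (simp add: linearly_independent_pair_def dim_eq_card_independent)
    ultimately show ?thesis by blast
  qed
  ultimately show ?thesis by blast
qed

end
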